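(* Let $g=(g_1,\ldots,g_m)\colon\mathbb{R}^n\to\mathbb{R}^m$ with $g_j(x)=\max_{i\in I_j}g_{j,i}(x)$, where each $g_{j,i}$ is convex and continuously differentiable on $\mathbb{R}^n$ and each $I_j$ is finite. Fix $\bar x\in\Omega=\{x\in\mathbb{R}^n:g(x)\le0\}$, set $J(\bar x)=\{j:g_j(\bar x)=0\}$, assumed nonempty, and $I_j(\bar x)=\{i\in I_j:g_{j,i}(\bar x)=0\}$ for $j\in J(\bar x)$, and define $$K:=\operatorname{cone}\{\nabla g_{j,i}(\bar x):j\in J(\bar x),\ i\in I_j(\bar x)\}.$$ Let $B_K$ denote the normalized conic base of $K$ and $d:=-P_{\operatorname{aff}(B_K)}(0)$. Suppose that $$\{x\in\mathbb{R}^n:\langle\nabla g_{j,i}(\bar x),x-\bar x\rangle<0\text{ for all }j\in J(\bar x),\ i\in I_j(\bar x)\}\ne\emptyset.$$ Then $d+v$ is an interior feasible direction for $\Omega$ at $\bar x$ for every $v\in\mathbb{R}^n$ with $\|v\|<\|d\|^2$.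
   Context: $\langle\cdot,\cdot\rangle$ and $\|\cdot\|$ are the Euclidean inner product and norm; $g(x)\le0$ is componentwise. The normalized conic base $B_K$ of a finitely generated cone $K$ is the set of unit vectors along its extreme rays. $\operatorname{aff}(B_K)$ is the affine hull and $P_{\operatorname{aff}(B_K)}(0)$ is the orthogonal projection of the origin onto it (this is the circumcenter of $B_K$). The tangent cone is $T_\Omega(\bar x)=\{v\in\mathbb{R}^n:\exists\, v_k\to v,\ t_k\downarrow0,\ \bar x+t_kv_k\in\Omega\}$. An interior feasible direction for $\Omega$ at $\bar x$ is an element of the interior of $T_\Omega(\bar x)$. *)

theory Defs
  imports "HOL-Analysis.Analysis"
begin

definition gradient :: "('a::real_inner \<Rightarrow> real) \<Rightarrow> 'a \<Rightarrow> 'a" where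
  "gradient f x = (THE D. GDERIV f x :> D)"

lemma GDERIV_gradient:
  fixes f :: "'a::euclidean_space \<Rightarrow> real"
  assumes "f differentiable (at x)"
  shows "GDERIV f x :> gradient f x"
proof -
  obtain f' where f': "(f has_derivative f') (at x)"
    using assms by (auto simp: differentiable_def)
  interpret bounded_linear f' using f' by (rule has_derivative_bounded_linear)
  define D where "D = (\<Sum>b\<in>Basis. f' b *\<^sub>R b)"
  have "f' h = h \<bullet> D" for h
  proof -
    have "f' h = f' (\<Sum>b\<in>Basis. (h \<bullet> b) *\<^sub>R b)"
      by (simp add: euclidean_representation)
    also have "\<dots> = h \<bullet> D"
      by (simp add: sum scaleR D_def inner_sum_right mult.commute)
    finally show ?thesis .
  qed
  then have "f' = (\<lambda>h. h \<bullet> D)" by auto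
  with f' have D: "GDERIV f x :> D" by (simp add: gderiv_def)
  show ?thesis
    unfolding gradient_def
  proof (rule theI[where P = "\<lambda>D. GDERIV f x :> D", OF D])
    fix E assume "GDERIV f x :> E"
    then have "(\<lambda>h. h \<bullet> E) = (\<lambda>h. h \<bullet> D)"
      using D by (simp add: gderiv_def has_derivative_unique)
    then have "(E - D) \<bullet> E = (E - D) \<bullet> D"
      by (rule fun_cong)
    then have "(E - D) \<bullet> (E - D) = 0"
      by (simp add: inner_diff_right)
    then show "E = D"
      by simp
  qed
qed

(* conic hull {u} is the half-line of all t *\<^sub>R u with t \<ge> 0. *)
definition extreme_ray_of :: "'a::real_vector set \<Rightarrow> 'a set \<Rightarrow> bool"  (infixr "extreme'_ray'_of" 50) where
  "R extreme_ray_of K \<longleftrightarrow> R face_of K \<and> (\<exists>u. u \<noteq> 0 \<and> R = conic hull {u})"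

definition conic_base :: "'a::real_normed_vector set \<Rightarrow> 'a set" where
  "conic_base K = {u. norm u = 1 \<and> (\<exists>R. R extreme_ray_of K \<and> u \<in> R)}"

definition tangent_cone :: "'a::real_normed_vector set \<Rightarrow> 'a \<Rightarrow> 'a set" where
  "tangent_cone \<Omega> x = {v. \<exists>w t. w \<longlonglongrightarrow> v \<and> (\<forall>k. 0 < t k) \<and> decseq t \<and> t \<longlonglongrightarrow> 0 \<and>
     (\<forall>k::nat. x + t k *\<^sub>R w k \<in> \<Omega>)}"

definition interior_feasible_direction :: "'a::real_normed_vector set \<Rightarrow> 'a \<Rightarrow> 'a \<Rightarrow> bool" where
  "interior_feasible_direction \<Omega> x v \<longleftrightarrow> v \<in> interior (tangent_cone \<Omega> x)"

end

theory Submission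
  imports Defs
begin

text \<open>
  If \<open>p\<close> is the projection of the origin onto the affine hull of the base \<open>B\<close>, then
  \<open>u \<bullet> p \<ge> \<parallel>p\<parallel>\<^sup>2\<close> for every \<open>u \<in> B\<close>, so \<open>u \<bullet> (v - p) < 0\<close> as soon as \<open>\<parallel>v\<parallel> < \<parallel>p\<parallel>\<^sup>2\<close>.
  The Slater-type condition makes \<open>K\<close> pointed; the slice of \<open>K\<close> by a hyperplane is then a
  polytope whose vertices span extreme rays, and by Minkowski's theorem the strict inequality
  passes from \<open>B\<close> to all active gradients. Directions with negative inner product against all
  active gradients form an open set of feasible directions.
\<close>

text \<open>A segment in \<open>K\<close> that meets the ray can be rescaled, endpoint by endpoint,
  to height 1 under \<open>y\<close>. The result is a segment in the slice through \<open>c\<close>,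
  and extremality of \<open>c\<close> collapses it.\<close>

lemma extreme_ray_of_slice:
  fixes K :: "'a::real_inner set"
  assumes K: "convex_cone K"
    and pos: "\<And>x. x \<in> K \<Longrightarrow> x \<noteq> 0 \<Longrightarrow> 0 < y \<bullet> x"
    and c: "c extreme_point_of {x \<in> K. y \<bullet> x = 1}"
  shows "(conic hull {c}) extreme_ray_of K"
proof -
  have cK: "c \<in> K" and yc: "y \<bullet> c = 1"
    using c by (auto simp: extreme_point_of_def)
  have scale: "t *\<^sub>R x \<in> K" if "x \<in> K" "0 \<le> t" for t x
    using K that by (auto simp: convex_cone_iff)
  have nonneg: "0 \<le> y \<bullet> x" if "x \<in> K" for x
    using pos[OF that] by (cases "x = 0") auto
  have "conic hull {c} face_of K"
    unfolding face_of_def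
  proof (intro conjI ballI impI)
    show "conic hull {c} \<subseteq> K"
      using cK scale by (auto simp: conic_hull_explicit)
    show "convex (conic hull {c})"
      by (simp add: convex_conic_hull)
  next
    fix a b x
    assume ab: "a \<in> K" "b \<in> K" and x: "x \<in> conic hull {c}" and seg: "x \<in> open_segment a b"
    obtain t where t: "0 \<le> t" "x = t *\<^sub>R c"
      using x by (auto simp: conic_hull_explicit)
    obtain u where u: "0 < u" "u < 1" "x = (1 - u) *\<^sub>R a + u *\<^sub>R b"
      using seg by (auto simp: in_segment)
    have teq: "t = (1 - u) * (y \<bullet> a) + u * (y \<bullet> b)"
      using arg_cong[OF u(3), of "inner y"] t(2) yc by (simp add: inner_add_right)
    \<comment> \<open>An endpoint of height 0 cannot be normalized, but \<open>pos\<close> forces it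
      to be 0, and then the other endpoint is visibly a multiple of \<open>c\<close>.\<close>
    have ray: "a \<in> conic hull {c} \<and> b \<in> conic hull {c}"
    proof (cases "y \<bullet> a = 0 \<or> y \<bullet> b = 0")
      case True
      then have "a = 0 \<or> b = 0"
        using pos ab by force
      then show ?thesis
      proof
        assume a0: "a = 0"
        then have "u *\<^sub>R b = t *\<^sub>R c"
          using u(3) t(2) by simp
        then have "(1 / u) *\<^sub>R (u *\<^sub>R b) = (1 / u) *\<^sub>R (t *\<^sub>R c)"
          by simp
        then have "b = (t / u) *\<^sub>R c"
          using u(1) by simp
        moreover have "a = 0 *\<^sub>R c" using a0 by simp
        ultimately show ?thesis
          unfolding conic_hull_explicit using t(1) u(1) by (auto intro: exI[of _ 0] exI[of _ "t / u"])
      next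
        assume b0: "b = 0"
        then have "(1 - u) *\<^sub>R a = t *\<^sub>R c"
          using u(3) t(2) by simp
        then have "(1 / (1 - u)) *\<^sub>R ((1 - u) *\<^sub>R a) = (1 / (1 - u)) *\<^sub>R (t *\<^sub>R c)"
          by simp
        then have "a = (t / (1 - u)) *\<^sub>R c"
          using u(2) by simp
        moreover have "b = 0 *\<^sub>R c" using b0 by simp
        ultimately show ?thesis
          unfolding conic_hull_explicit using t(1) u(2)
          by (auto intro: exI[of _ 0] exI[of _ "t / (1 - u)"])
      qed
    next
      case False
      then have pa: "0 < y \<bullet> a" and pb: "0 < y \<bullet> b"
        using nonneg ab by force+
      have t0: "0 < t"
        using teq u pa pb by (simp add: add_pos_pos)
      define a' b' where "a' = (1 / (y \<bullet> a)) *\<^sub>R a" and "b' = (1 / (y \<bullet> b)) *\<^sub>R b"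
      have a: "a = (y \<bullet> a) *\<^sub>R a'" and b: "b = (y \<bullet> b) *\<^sub>R b'"
        using pa pb by (auto simp: a'_def b'_def)
      have slice: "a' \<in> {x \<in> K. y \<bullet> x = 1}" "b' \<in> {x \<in> K. y \<bullet> x = 1}"
        using pa pb scale ab by (auto simp: a'_def b'_def)
      \<comment> \<open>Since \<open>t\<close> is the height of \<open>x\<close>, \<open>s\<close>
        is the share of it contributed by \<open>b\<close>; these are the weights that express
        \<open>c\<close> through \<open>a'\<close> and \<open>b'\<close>.\<close>
      define s where "s = u * (y \<bullet> b) / t"
      have s: "0 < s" "1 - s = (1 - u) * (y \<bullet> a) / t"
        using u(1) pb t0 by (simp_all add: s_def teq[symmetric] diff_divide_eq_iff)
          (simp add: teq)
      have "0 < 1 - s"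
        unfolding s(2) using u(2) pa t0 by simp
      then have "s < 1"
        by simp
      have "t *\<^sub>R c = t *\<^sub>R ((1 - s) *\<^sub>R a' + s *\<^sub>R b')"
      proof -
        have "t *\<^sub>R c = ((1 - u) * (y \<bullet> a)) *\<^sub>R a' + (u * (y \<bullet> b)) *\<^sub>R b'"
          using t(2) u(3) a b by (metis scaleR_scaleR)
        then show ?thesis
          using t0 unfolding s(2) by (simp add: s_def scaleR_add_right)
      qed
      then have c_eq: "c = (1 - s) *\<^sub>R a' + s *\<^sub>R b'"
        using t0 by simp
      have "c \<notin> open_segment a' b'"
        using c slice by (auto simp: extreme_point_of_def)
      then have "a' = b'"
        using c_eq s(1) \<open>s < 1\<close> by (auto simp: in_segment)
      then have "a' = c" "b' = c"
        using c_eq by (simp_all add: scaleR_left_distrib[symmetric])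
      then show ?thesis
        using a b pa pb unfolding conic_hull_explicit by (auto intro: less_imp_le)
    qed
    show "a \<in> conic hull {c}" "b \<in> conic hull {c}"
      using ray by auto
  qed
  moreover have "c \<noteq> 0"
    using yc by auto
  ultimately show ?thesis
    unfolding extreme_ray_of_def by blast
qed

text \<open>A generator need not span an extreme ray, so the bound on the base has to be carried
  over to it. The vector \<open>w\<close> serves only to cut \<open>K\<close> in a compact
  slice.\<close>

lemma negative_on_generators:
  fixes A :: "'a::euclidean_space set"
  assumes "finite A"
    and w: "\<And>a. a \<in> A \<Longrightarrow> a \<bullet> w < 0"
    and z: "\<And>u. u \<in> conic_base (convex_cone hull A) \<Longrightarrow> u \<bullet> z < 0"
    and "a \<in> A"
  shows "a \<bullet> z < 0"
proof -
  define K where "K = convex_cone hull A"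
  \<comment> \<open>The generators, rescaled to height 1 under \<open>- w\<close>.\<close>
  define S where "S = (\<lambda>a. (1 / (- w \<bullet> a)) *\<^sub>R a) ` A"
  have w': "0 < - w \<bullet> a" if "a \<in> A" for a
    using w[OF that] by (simp add: inner_commute)
  have K: "convex_cone K"
    unfolding K_def by (rule convex_cone_convex_cone_hull)
  have AK: "A \<subseteq> K"
    unfolding K_def by (rule hull_subset)
  have "S \<subseteq> K"
    using K AK w' less_imp_le unfolding S_def convex_cone_iff
    by (smt (verit, best) divide_nonneg_nonneg image_subset_iff subsetD)
  then have hull_K: "convex hull S \<subseteq> K"
    using K by (simp add: hull_minimal convex_cone_def)
  have "convex hull S \<subseteq> {x. - w \<bullet> x = 1}"
    using w' by (intro hull_minimal) (force simp: S_def convex_hyperplane)+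
  then have hull_1: "- w \<bullet> x = 1" if "x \<in> convex hull S" for x
    using that by blast
  \<comment> \<open>Undoing the rescaling shows that \<open>S\<close> still generates
    \<open>K\<close>, so each nonzero point of \<open>K\<close> is a multiple of a point of
    \<open>convex hull S\<close>.\<close>
  have "A \<subseteq> convex_cone hull S"
  proof
    fix a assume a: "a \<in> A"
    then have "(1 / (- w \<bullet> a)) *\<^sub>R a \<in> convex_cone hull S"
      by (auto simp: S_def intro!: hull_inc)
    then have "(- w \<bullet> a) *\<^sub>R ((1 / (- w \<bullet> a)) *\<^sub>R a) \<in> convex_cone hull S"
      using w'[OF a] convex_cone_convex_cone_hull[of S] less_imp_le
      unfolding convex_cone_iff by blast
    then show "a \<in> convex_cone hull S"
      using w'[OF a] by simp
  qed
  then have "K \<subseteq> convex_cone hull S"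
    unfolding K_def by (simp add: hull_minimal convex_cone_convex_cone_hull)
  then have rep: "\<exists>t q. 0 \<le> t \<and> q \<in> convex hull S \<and> x = t *\<^sub>R q" if "x \<in> K" "x \<noteq> 0" for x
    using that unfolding convex_cone_hull_convex_hull by fastforce
  have pos: "0 < - w \<bullet> x" if "x \<in> K" "x \<noteq> 0" for x
  proof -
    obtain t q where "0 \<le> t" "q \<in> convex hull S" "x = t *\<^sub>R q"
      using rep[OF \<open>x \<in> K\<close> \<open>x \<noteq> 0\<close>] by blast
    then show ?thesis
      using hull_1[of q] \<open>x \<noteq> 0\<close> by (cases "t = 0") auto
  qed
  have slice: "{x \<in> K. - w \<bullet> x = 1} = convex hull S"
  proof (intro equalityI subsetI)
    fix x assume "x \<in> {x \<in> K. - w \<bullet> x = 1}"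
    then have x: "x \<in> K" "- w \<bullet> x = 1" "x \<noteq> 0"
      by auto
    then obtain t q where q: "q \<in> convex hull S" "x = t *\<^sub>R q"
      using rep by blast
    then have "t = 1"
      using x(2) hull_1[OF q(1)] by simp
    then show "x \<in> convex hull S"
      using q by simp
  qed (use hull_K hull_1 in auto)
  \<comment> \<open>A vertex of the slice, scaled to unit length, lies in the base; positive scaling
    keeps the sign.\<close>
  have "c \<bullet> z < 0" if "c extreme_point_of convex hull S" for c
  proof -
    have "(conic hull {c}) extreme_ray_of K"
      using extreme_ray_of_slice[OF K pos] that unfolding slice by blast
    moreover have "(1 / norm c) *\<^sub>R c \<in> conic hull {c}"
      unfolding conic_hull_explicit by (auto intro: exI[of _ "1 / norm c"])
    moreover have "c \<noteq> 0"
      using hull_1[of c] that by (auto simp: extreme_point_of_def)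
    ultimately have "(1 / norm c) *\<^sub>R c \<in> conic_base K"
      unfolding conic_base_def by auto
    then have "((1 / norm c) *\<^sub>R c) \<bullet> z < 0"
      using z unfolding K_def by blast
    then show ?thesis
      using \<open>c \<noteq> 0\<close> by (simp add: divide_less_0_iff)
  qed
  then have "{c. c extreme_point_of convex hull S} \<subseteq> {x. z \<bullet> x < 0}"
    by (auto simp: inner_commute)
  then have "convex hull {c. c extreme_point_of convex hull S} \<subseteq> {x. z \<bullet> x < 0}"
    by (rule hull_minimal) (rule convex_halfspace_lt)
  \<comment> \<open>Compactness makes the slice the convex hull of its vertices, all of which lie in
    a convex open half-space.\<close>
  moreover have "compact (convex hull S)"
    using \<open>finite A\<close> by (simp add: S_def finite_imp_compact_convex_hull)
  ultimately have hull_z: "convex hull S \<subseteq> {x. z \<bullet> x < 0}"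
    using Krein_Milman_Minkowski[of "convex hull S"] by (simp add: convex_convex_hull)
  have "(1 / (- w \<bullet> a)) *\<^sub>R a \<in> convex hull S"
    using \<open>a \<in> A\<close> by (auto simp: S_def intro!: hull_inc)
  then have "z \<bullet> ((1 / (- w \<bullet> a)) *\<^sub>R a) < 0"
    using hull_z by blast
  then show ?thesis
    using w[OF \<open>a \<in> A\<close>] by (simp add: inner_commute zero_less_divide_iff)
qed

text \<open>This is the variational inequality \<open>(0 - p) \<bullet> (u - p) \<le> 0\<close> for
  the projection \<open>p\<close> of the origin, expanded.\<close>

lemma inner_closest_point_ge:
  fixes S :: "'a::euclidean_space set"
  assumes "convex S" "closed S" "u \<in> S"
  shows "(norm (closest_point S 0))\<^sup>2 \<le> u \<bullet> closest_point S 0"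
  using closest_point_dot[OF assms, of 0]
  by (simp add: inner_diff_right inner_commute power2_norm_eq_inner)

text \<open>By the chain rule, \<open>f\<close> restricted to the ray from \<open>x\<close> along
  \<open>z\<close> has slope \<open>D \<bullet> z\<close> at 0.\<close>

lemma GDERIV_neg_imp_eventually_less:
  assumes "GDERIV f x :> D" and "D \<bullet> z < 0"
  shows "\<forall>\<^sub>F t in at_right 0. f (x + t *\<^sub>R z) < f x"
proof -
  have "((\<lambda>t. x + t *\<^sub>R z) has_derivative (\<lambda>t. t *\<^sub>R z)) (at 0)"
    by (auto intro!: derivative_eq_intros)
  moreover have "(f has_derivative (\<lambda>h. h \<bullet> D)) (at (x + 0 *\<^sub>R z))"
    using assms(1) by (simp add: gderiv_def)
  ultimately have "((\<lambda>t. f (x + t *\<^sub>R z)) has_derivative (\<lambda>t. (t *\<^sub>R z) \<bullet> D)) (at 0)"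
    by (rule has_derivative_compose)
  then have "((\<lambda>t. f (x + t *\<^sub>R z)) has_real_derivative D \<bullet> z) (at 0)"
    by (simp add: has_field_derivative_def inner_commute mult_commute_abs)
  from DERIV_neg_dec_right[OF this assms(2)] show ?thesis
    by (auto simp: eventually_at_right_field)
qed

lemma tangent_coneI:
  assumes "\<forall>\<^sub>F t in at_right 0. x + t *\<^sub>R z \<in> \<Omega>"
  shows "z \<in> tangent_cone \<Omega> x"
proof -
  obtain e where e: "0 < e" "\<And>t. 0 < t \<Longrightarrow> t < e \<Longrightarrow> x + t *\<^sub>R z \<in> \<Omega>"
    using assms by (auto simp: eventually_at_right_field)
  \<comment> \<open>The factor \<open>e / 2\<close> keeps already the first term strictly below
    \<open>e\<close>; the directions are constantly \<open>z\<close>.\<close>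
  define t where "t k = e / 2 * inverse (real (Suc k))" for k
  have "t \<longlonglongrightarrow> 0"
    unfolding t_def using tendsto_mult_right_zero[OF LIMSEQ_inverse_real_of_nat] .
  moreover have "decseq t"
    using e(1) by (auto simp: t_def decseq_def intro!: mult_left_mono le_imp_inverse_le)
  moreover have "0 < t k" "t k < e" for k
    using e(1) by (auto simp: t_def field_simps add_pos_nonneg)
  ultimately show ?thesis
    unfolding tangent_cone_def using e(2)
    by (intro CollectI exI[of _ "\<lambda>_. z"] exI[of _ t]) auto
qed

theorem corollary8p1:
  fixes G :: "'m::finite \<Rightarrow> 'i \<Rightarrow> real ^ 'n \<Rightarrow> real"
    and I :: "'m \<Rightarrow> 'i set"
    and g :: "real ^ 'n \<Rightarrow> real ^ 'm"
    and xbar :: "real ^ 'n"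
  defines "\<Omega> \<equiv> {x. g x \<le> 0}"
  defines "J \<equiv> {j. g xbar $ j = 0}"
  defines "Iact \<equiv> (\<lambda>j. {i \<in> I j. G j i xbar = 0})"
  defines "K \<equiv> convex_cone hull {gradient (G j i) xbar | j i. j \<in> J \<and> i \<in> Iact j}"
  defines "d \<equiv> - closest_point (affine hull (conic_base K)) 0"
  assumes finite_I: "\<And>j. finite (I j)" and nonempty_I: "\<And>j. I j \<noteq> {}"
    and g_max: "\<And>x j. g x $ j = Max ((\<lambda>i. G j i x) ` I j)"
    and convex_G: "\<And>j i. i \<in> I j \<Longrightarrow> convex_on UNIV (G j i)"
    and diff_G: "\<And>j i x. i \<in> I j \<Longrightarrow> G j i differentiable (at x)"
    and cont_grad_G: "\<And>j i. i \<in> I j \<Longrightarrow> continuous_on UNIV (gradient (G j i))"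
    and xbar: "xbar \<in> \<Omega>"
    and J_nonempty: "J \<noteq> {}"
    and strict: "{x. \<forall>j\<in>J. \<forall>i\<in>Iact j. gradient (G j i) xbar \<bullet> (x - xbar) < 0} \<noteq> {}"
  shows "\<forall>v. norm v < (norm d)\<^sup>2 \<longrightarrow> interior_feasible_direction \<Omega> xbar (d + v)"
proof (intro allI impI)
  fix v :: "real ^ 'n"
  assume v: "norm v < (norm d)\<^sup>2"
  define A where "A = {gradient (G j i) xbar | j i. j \<in> J \<and> i \<in> Iact j}"
  define D where "D = {z. \<forall>a\<in>A. a \<bullet> z < 0}"
  have "A = (\<Union>j\<in>J. (\<lambda>i. gradient (G j i) xbar) ` Iact j)"
    by (auto simp: A_def)
  then have "finite A"
    using finite_I by (simp add: Iact_def)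
  obtain x where x: "\<And>a. a \<in> A \<Longrightarrow> a \<bullet> (x - xbar) < 0"
    using strict by (auto simp: A_def)
  \<comment> \<open>Cauchy-Schwarz bounds \<open>u \<bullet> v\<close> by \<open>norm v\<close>,
    while the projection inequality gives
    \<open>u \<bullet> d \<le> - (norm d)\<^sup>2\<close>.\<close>
  have base: "u \<bullet> (d + v) < 0" if u: "u \<in> conic_base (convex_cone hull A)" for u
  proof -
    have "norm u = 1"
      using u by (simp add: conic_base_def)
    then have "u \<bullet> v \<le> norm v"
      using norm_cauchy_schwarz[of u v] by simp
    moreover have "(norm d)\<^sup>2 \<le> - (u \<bullet> d)"
      using inner_closest_point_ge[of "affine hull (conic_base K)" u] u
      by (simp add: d_def K_def A_def hull_inc affine_imp_convex)
    ultimately show ?thesis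
      using v by (simp add: inner_add_right)
  qed
  \<comment> \<open>The strictly feasible direction \<open>x - xbar\<close> plays the role of
    \<open>w\<close>.\<close>
  have "d + v \<in> D"
    using negative_on_generators[OF \<open>finite A\<close> x base] by (auto simp: D_def)
  moreover have "open D"
    unfolding D_def using \<open>finite A\<close>
    by (simp add: Collect_ball_eq open_INT open_halfspace_lt)
  moreover have "D \<subseteq> tangent_cone \<Omega> xbar"
  proof
    fix z assume z: "z \<in> D"
    have le: "G j i y \<le> g y $ j" if "i \<in> I j" for i j y
      using that finite_I by (simp add: g_max)
    have g_le: "g xbar $ j \<le> 0" for j
      using xbar by (simp add: \<Omega>_def less_eq_vec_def)
    have ev: "\<forall>\<^sub>F t in at_right 0. G j i (xbar + t *\<^sub>R z) < 0" if i: "i \<in> I j" for i j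
    proof (cases "G j i xbar = 0")
      case True
      \<comment> \<open>The vanishing piece bounds the maximum from below and feasibility bounds it
        from above, so \<open>j\<close> is active.\<close>
      have "g xbar $ j = 0"
        using le[OF i, of xbar] g_le[of j] True by simp
      then have "gradient (G j i) xbar \<in> A"
        using i True by (auto simp: A_def J_def Iact_def)
      then have "gradient (G j i) xbar \<bullet> z < 0"
        using z by (auto simp: D_def)
      from GDERIV_neg_imp_eventually_less[OF GDERIV_gradient[OF diff_G[OF i]] this]
      show ?thesis
        by (simp add: True)
    next
      case False
      \<comment> \<open>An inactive piece is strictly negative at \<open>xbar\<close> and stays so
        nearby by continuity.\<close>
      then have "G j i xbar < 0"
        using le[OF i, of xbar] g_le[of j] by simp
      moreover have "isCont (G j i) xbar"
        using diff_G[OF i] by (rule differentiable_imp_continuous_within)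
      then have "((\<lambda>t. G j i (xbar + t *\<^sub>R z)) \<longlongrightarrow> G j i xbar) (at_right 0)"
        by (rule isCont_tendsto_compose) (auto intro!: tendsto_eq_intros)
      ultimately show ?thesis
        by (auto dest: order_tendstoD(2))
    qed
    \<comment> \<open>There are finitely many pieces in all, so one right neighbourhood of 0 works
      for every one of them.\<close>
    have "\<forall>\<^sub>F t in at_right 0. \<forall>j\<in>UNIV. \<forall>i\<in>I j. G j i (xbar + t *\<^sub>R z) < 0"
      using finite_I ev by (intro eventually_ball_finite ballI) auto
    then have "\<forall>\<^sub>F t in at_right 0. xbar + t *\<^sub>R z \<in> \<Omega>"
      by eventually_elim
        (use finite_I nonempty_I in \<open>auto simp: \<Omega>_def less_eq_vec_def g_max less_imp_le\<close>)
    then show "z \<in> tangent_cone \<Omega> xbar"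
      by (rule tangent_coneI)
  qed
  ultimately show "interior_feasible_direction \<Omega> xbar (d + v)"
    unfolding interior_feasible_direction_def by (metis interiorI)
qed

end
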